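(* The hypothesis "one-to-one" cannot be omitted from the theorem "if $X$ is a subspace of the Cantor set $\mathbf{C}$ and $f:X\to Y$ is a continuous bijection such that the image under $f$ of every open set in $X$ is resolvable in $Y$, then $f$ is scatteredly open". That is: there exist a subspace $X$ of the Cantor set $\mathbf{C}$, a metrizable space $Y$, and a continuous surjection $f:X\to Y$ such that $f(U)$ is resolvable in $Y$ for every open set $U\subset X$, but $f$ is not scatteredly open.
   Context: A subset $E$ of a metrizable space $Y$ is called resolvable in $Y$ if for each nonempty closed subset $F$ of $Y$ we have $\mathrm{cl}_Y(F\cap E)\cap \mathrm{cl}_Y(F\setminus E)\neq F$. Let $X$ be a subspace of the Cantor set $\mathbf{C}$. A function $f:X\to Y$ is called piecewise open if $X$ admits a countable cover $\mathcal{V}$ by pairwise disjoint closed subsets of $X$ such that for each $V\in\mathcal{V}$ the restriction $f|V$ is open as a map $V\to f(V)$, where $V$ and $f(V)$ carry the subspace topologies. The function $f$ is called scatteredly open if there is such a cover $\mathcal{V}$ which is, in addition, scattered, that is: for every nonempty subfamily $\mathcal{T}\subset\mathcal{V}$ there is a clopen set $G\subset X$ such that $\mathcal{T}_G=\{T\in\mathcal{T}: T\subset G\}$ is a singleton and $T\cap G=\emptyset$ for every $T\in\mathcal{T}\setminus\mathcal{T}_G$. *)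

theory Defs
  imports "HOL-Analysis.Analysis"
begin

definition cantor_set :: "(nat \<Rightarrow> bool) topology" where
  "cantor_set = product_topology (\<lambda>_. discrete_topology UNIV) UNIV"

definition resolvable_in :: "'b topology \<Rightarrow> 'b set \<Rightarrow> bool" where
  "resolvable_in Y E \<longleftrightarrow>
     E \<subseteq> topspace Y \<and>
     (\<forall>F. closedin Y F \<and> F \<noteq> {} \<longrightarrow>
        Y closure_of (F \<inter> E) \<inter> Y closure_of (F - E) \<noteq> F)"

definition piecewise_open_cover ::
  "'a topology \<Rightarrow> 'b topology \<Rightarrow> ('a \<Rightarrow> 'b) \<Rightarrow> 'a set set \<Rightarrow> bool" where
  "piecewise_open_cover X Y f \<V> \<longleftrightarrow>
     countable \<V> \<and> \<Union>\<V> = topspace X \<and> pairwise disjnt \<V> \<and>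
     (\<forall>V\<in>\<V>. closedin X V \<and>
        open_map (subtopology X V) (subtopology Y (f ` V)) f)"

definition piecewise_open :: "'a topology \<Rightarrow> 'b topology \<Rightarrow> ('a \<Rightarrow> 'b) \<Rightarrow> bool" where
  "piecewise_open X Y f \<longleftrightarrow> (\<exists>\<V>. piecewise_open_cover X Y f \<V>)"

text \<open>The empty set is not excluded as a member of a cover or of a scattered family; its presence
  affects neither notion.\<close>

definition scattered_family :: "'a topology \<Rightarrow> 'a set set \<Rightarrow> bool" where
  "scattered_family X \<V> \<longleftrightarrow>
     (\<forall>\<T>. \<T> \<subseteq> \<V> \<and> \<T> \<noteq> {} \<longrightarrow>
        (\<exists>G. openin X G \<and> closedin X G \<and>
             is_singleton {T \<in> \<T>. T \<subseteq> G} \<and>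
             (\<forall>T \<in> \<T> - {T \<in> \<T>. T \<subseteq> G}. T \<inter> G = {})))"

definition scatteredly_open :: "'a topology \<Rightarrow> 'b topology \<Rightarrow> ('a \<Rightarrow> 'b) \<Rightarrow> bool" where
  "scatteredly_open X Y f \<longleftrightarrow>
     (\<exists>\<V>. piecewise_open_cover X Y f \<V> \<and> scattered_family X \<V>)"

end

theory Submission
  imports Defs
begin

text \<open>
  A scatteredly open map on a nonempty space restricts to an open map onto its image on some
  nonempty clopen set, so it suffices to violate this. The space \<open>X\<close> is obtained from the product
  of two Cantor sets by deleting countably many sets \<open>S\<^sub>p \<times> W\<^sub>p\<close>, and \<open>f\<close> is the projection to the
  first factor. Here \<open>S\<^sub>p\<close> is a sequence converging to \<open>p\<close>, and \<open>W\<^sub>p\<close> is clopen, such that every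
  nonempty open set is contained in only finitely many \<open>W\<^sub>p\<close>, while the \<open>{p} \<times> W\<^sub>p\<close> are dense in the
  sense that every box \<open>V \<times> W\<close> contains one of them with \<open>W\<^sub>p \<noteq> W\<close>. By the first property the image of
  an open set \<open>U\<close> contains a neighbourhood of each of its points up to a scattered set, and so
  is resolvable. By the second, \<open>f\<close> is not open onto its image on any nonempty open set: near \<open>p\<close> the
  image of \<open>W\<^sub>p\<close> misses the points of \<open>S\<^sub>p\<close>, which are in the image of the larger set.
\<close>

section \<open>Neighbourhoods in the Cantor set\<close>

lemma openin_cantor_set:
  "openin cantor_set U \<longleftrightarrow> (\<forall>x\<in>U. \<exists>L. \<forall>y. (\<forall>j<L. y j = x j) \<longrightarrow> y \<in> U)"
proof
  assume U: "openin cantor_set U"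
  show "\<forall>x\<in>U. \<exists>L. \<forall>y. (\<forall>j<L. y j = x j) \<longrightarrow> y \<in> U"
  proof
    fix x assume "x \<in> U"
    then obtain W where W: "finite {i. W i \<noteq> (UNIV :: bool set)}" "x \<in> Pi\<^sub>E UNIV W" "Pi\<^sub>E UNIV W \<subseteq> U"
      using U unfolding cantor_set_def openin_product_topology_alt by fastforce
    then obtain L where L: "\<forall>i\<in>{i. W i \<noteq> UNIV}. i < L"
      using finite_nat_set_iff_bounded by meson
    have "y \<in> U" if "\<forall>j<L. y j = x j" for y
    proof -
      have "y i \<in> W i" for i
        using that L W(2) by (cases "W i = UNIV") (auto simp: PiE_iff)
      then show ?thesis
        using W(3) by (auto simp: PiE_iff)
    qed
    then show "\<exists>L. \<forall>y. (\<forall>j<L. y j = x j) \<longrightarrow> y \<in> U"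
      by blast
  qed
next
  assume *: "\<forall>x\<in>U. \<exists>L. \<forall>y. (\<forall>j<L. y j = x j) \<longrightarrow> y \<in> U"
  show "openin cantor_set U"
    unfolding cantor_set_def openin_product_topology_alt
  proof
    fix x assume "x \<in> U"
    then obtain L where L: "\<And>y. (\<forall>j<L. y j = x j) \<Longrightarrow> y \<in> U"
      using * by blast
    let ?W = "\<lambda>i. if i < L then {x i} else UNIV"
    have "{i \<in> UNIV. ?W i \<noteq> topspace (discrete_topology UNIV)} \<subseteq> {..<L}"
      by auto
    then have "finite {i \<in> UNIV. ?W i \<noteq> topspace (discrete_topology UNIV)}"
      by (rule finite_subset) simp
    moreover have "Pi\<^sub>E UNIV ?W \<subseteq> U"
    proof
      fix y assume "y \<in> Pi\<^sub>E UNIV ?W"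
      then have "y j \<in> ?W j" for j
        by blast
      then show "y \<in> U"
        by (intro L) (metis singletonD)
    qed
    moreover have "x \<in> Pi\<^sub>E UNIV ?W"
      by (auto simp: PiE_iff)
    ultimately show "\<exists>W. finite {i \<in> UNIV. W i \<noteq> topspace (discrete_topology UNIV)} \<and>
        (\<forall>i\<in>UNIV. openin (discrete_topology UNIV) (W i)) \<and> x \<in> Pi\<^sub>E UNIV W \<and> Pi\<^sub>E UNIV W \<subseteq> U"
      by (intro exI[of _ ?W]) auto
  qed
qed

lemma topspace_cantor_set [simp]: "topspace cantor_set = UNIV"
  by (simp add: cantor_set_def)

lemma openin_cylinder: "openin cantor_set {y. \<forall>j<L. y j = x j}"
  unfolding openin_cantor_set by (auto intro!: exI[of _ L])

lemma in_closure_of_cantor_set: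
  assumes "x \<in> cantor_set closure_of A"
  shows "\<exists>a\<in>A. \<forall>j<L. a j = x j"
proof -
  have "\<exists>a. a \<in> A \<and> a \<in> T" if "x \<in> T \<and> openin cantor_set T" for T
    using assms that unfolding in_closure_of by blast
  from this[OF conjI, OF _ openin_cylinder[of L x]] show ?thesis
    by auto
qed

lemma metrizable_space_cantor_set: "metrizable_space cantor_set"
  unfolding cantor_set_def metrizable_space_product_topology
  by (auto intro: countable_subset[OF subset_UNIV])

text \<open>The clopen set isolating one nonempty member misses all others, so it equals that
  member, the family being a cover.\<close>

lemma scatteredly_open_imp_open_on_clopen:
  assumes "scatteredly_open X Y f" and "topspace X \<noteq> {}"
  obtains V where "openin X V" "closedin X V" "V \<noteq> {}"
    "open_map (subtopology X V) (subtopology Y (f ` V)) f"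
proof -
  obtain \<V> where cover: "piecewise_open_cover X Y f \<V>" and sc: "scattered_family X \<V>"
    using assms(1) unfolding scatteredly_open_def by blast
  let ?T = "\<V> - {{}}"
  have un: "\<Union>\<V> = topspace X"
    using cover unfolding piecewise_open_cover_def by blast
  then have "?T \<subseteq> \<V> \<and> ?T \<noteq> {}"
    using assms(2) by blast
  from sc[unfolded scattered_family_def, rule_format, OF this]
  obtain G where G: "openin X G" "closedin X G" "is_singleton {T \<in> ?T. T \<subseteq> G}"
    "\<forall>T \<in> ?T - {T \<in> ?T. T \<subseteq> G}. T \<inter> G = {}"
    by (elim exE conjE) (rule that)
  obtain V where V: "{T \<in> ?T. T \<subseteq> G} = {V}"
    using G(3) by (rule is_singletonE)
  have "G \<subseteq> topspace X"
    using G(1) by (rule openin_subset)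
  then have "G \<subseteq> V"
    using G(4) un unfolding V by blast
  then have "G = V" "V \<in> \<V>" "V \<noteq> {}"
    using V by blast+
  with G(1,2) cover that show thesis
    unfolding piecewise_open_cover_def by blast
qed

text \<open>
  Identifying binary sequences with sets of naturals, \<open>deleted y z\<close> says that the second largest
  element of \<open>y\<close> is an even number \<open>2 * N\<close>, so that \<open>y\<close> belongs to the sequence
  \<open>S\<^sub>p = {insert k p | k > 2 * N}\<close> where \<open>p = y \<inter> {..2 * N}\<close>, and that \<open>z\<close> belongs to the cylinder
  \<open>W\<^sub>p\<close> given by the digits \<open>N, \<dots>, 2 * N\<close> of \<open>p\<close>. Thus \<open>p\<close> itself encodes \<open>W\<^sub>p\<close>.
\<close>

definition deleted :: "(nat \<Rightarrow> bool) \<Rightarrow> (nat \<Rightarrow> bool) \<Rightarrow> bool" where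
  "deleted y z \<longleftrightarrow> (\<exists>N k. 2 * N < k \<and> y (2 * N) \<and> (\<forall>j>2 * N. y j \<longleftrightarrow> j = k) \<and>
     (\<forall>i\<le>N. z i = y (N + i)))"

text \<open>Even and odd digits serve as the two coordinates, which places the space inside
  \<open>cantor_set\<close> itself.\<close>

definition evens :: "(nat \<Rightarrow> 'a) \<Rightarrow> nat \<Rightarrow> 'a" where
  "evens x = (\<lambda>n. x (2 * n))"

definition odds :: "(nat \<Rightarrow> 'a) \<Rightarrow> nat \<Rightarrow> 'a" where
  "odds x = (\<lambda>n. x (2 * n + 1))"

definition interleave :: "(nat \<Rightarrow> 'a) \<Rightarrow> (nat \<Rightarrow> 'a) \<Rightarrow> nat \<Rightarrow> 'a" where
  "interleave y z = (\<lambda>n. if even n then y (n div 2) else z (n div 2))"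

definition punctured_square :: "(nat \<Rightarrow> bool) set" where
  "punctured_square = {x. \<not> deleted (evens x) (odds x)}"

lemma evens_interleave [simp]: "evens (interleave y z) = y"
  by (simp add: evens_def interleave_def)

lemma odds_interleave [simp]: "odds (interleave y z) = z"
  by (simp add: odds_def interleave_def)

lemma interleave_agree:
  assumes "\<forall>j<M. y j = evens x j" "\<forall>j<M. z j = odds x j" "n < M"
  shows "interleave y z n = x n"
proof -
  have "n div 2 < M"
    using assms(3) by linarith
  then have "y (n div 2) = x (2 * (n div 2))" "z (n div 2) = x (2 * (n div 2) + 1)"
    using assms(1,2) by (auto simp: evens_def odds_def)
  then show ?thesis
    by (auto simp: interleave_def)
qed

lemma interleave_in_punctured_square [simp]:
  "interleave y z \<in> punctured_square \<longleftrightarrow> \<not> deleted y z"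
  by (simp add: punctured_square_def)

lemma openin_punctured_squareD:
  assumes "openin (subtopology cantor_set punctured_square) U" and "x \<in> U"
  obtains M where
    "\<And>y z. \<lbrakk>\<forall>j<M. y j = evens x j; \<forall>j<M. z j = odds x j; \<not> deleted y z\<rbrakk> \<Longrightarrow> interleave y z \<in> U"
proof -
  obtain T where T: "openin cantor_set T" "U = T \<inter> punctured_square"
    using assms(1) unfolding openin_subtopology by blast
  then obtain M where "\<And>x'. (\<forall>j<M. x' j = x j) \<Longrightarrow> x' \<in> T"
    using assms(2) unfolding openin_cantor_set by blast
  then have "interleave y z \<in> U"
    if "\<forall>j<M. y j = evens x j" "\<forall>j<M. z j = odds x j" "\<not> deleted y z" for y z
    using that T(2) interleave_agree[OF that(1,2)] by simp
  then show thesis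
    by (rule that)
qed

lemma continuous_map_evens: "continuous_map cantor_set cantor_set evens"
  unfolding cantor_set_def evens_def continuous_map_componentwise_UNIV
  by (intro allI continuous_map_product_projection) simp

text \<open>The first \<open>M\<close> digits of \<open>z\<close> followed by zeros lie in the cylinder \<open>W\<^sub>p\<close> only if \<open>N < M\<close>, since
  the last digit defining \<open>W\<^sub>p\<close> is one.\<close>

lemma deleted_truncation:
  assumes "deleted y (\<lambda>i. i < M \<and> z i)"
  obtains N k where "N < M" "2 * N < k" "y (2 * N)" "\<And>j. 2 * N < j \<Longrightarrow> y j \<longleftrightarrow> j = k"
proof -
  obtain N k where Nk: "2 * N < k" "y (2 * N)" "\<forall>j>2 * N. y j \<longleftrightarrow> j = k"
    "\<forall>i\<le>N. (i < M \<and> z i) = y (N + i)"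
    using assms unfolding deleted_def by blast
  have "N < M"
    using Nk(2) Nk(4)[rule_format, of N] by (simp add: mult_2)
  with Nk that show thesis
    by blast
qed

lemma evens_image_punctured_square: "evens ` punctured_square = UNIV"
proof -
  have "y \<in> evens ` punctured_square" for y
  proof (rule image_eqI)
    have "\<not> deleted y (\<lambda>_. False)"
      using deleted_truncation[of y 0 "\<lambda>_. False"] by auto
    then show "interleave y (\<lambda>_. False) \<in> punctured_square"
      by simp
  qed simp
  then show ?thesis
    by blast
qed

section \<open>Resolvability of the images\<close>

lemma resolvable_evens_image:
  assumes U: "openin (subtopology cantor_set punctured_square) U"
  shows "resolvable_in cantor_set (evens ` U)"
  unfolding resolvable_in_def
proof (intro conjI allI impI notI)
  fix F
  let ?E = "evens ` U"
  assume F: "closedin cantor_set F \<and> F \<noteq> {}"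
    and eq: "cantor_set closure_of (F \<inter> ?E) \<inter> cantor_set closure_of (F - ?E) = F"
  have clE: "\<exists>a\<in>F \<inter> ?E. \<forall>j<L. a j = y j" and clN: "\<exists>a\<in>F - ?E. \<forall>j<L. a j = y j"
    if "y \<in> F" for y L
  proof -
    have "y \<in> cantor_set closure_of (F \<inter> ?E)" "y \<in> cantor_set closure_of (F - ?E)"
      using that eq by auto
    then show "\<exists>a\<in>F \<inter> ?E. \<forall>j<L. a j = y j" "\<exists>a\<in>F - ?E. \<forall>j<L. a j = y j"
      by (simp_all only: in_closure_of_cantor_set)
  qed
  obtain y\<^sub>0 where "y\<^sub>0 \<in> F"
    using F by blast
  from clE[OF this] obtain x where x: "x \<in> U" "evens x \<in> F"
    by auto
  obtain M where M: "\<And>y z. \<lbrakk>\<forall>j<M. y j = evens x j; \<forall>j<M. z j = odds x j; \<not> deleted y z\<rbrakk>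
      \<Longrightarrow> interleave y z \<in> U"
    using openin_punctured_squareD[OF U x(1)] by blast
  define max_elt where "max_elt y k \<longleftrightarrow> (\<exists>N<M. 2 * N < k \<and> y (2 * N) \<and> (\<forall>j>2 * N. y j \<longleftrightarrow> j = k))"
    for y :: "nat \<Rightarrow> bool" and k
  have max_elt: "\<exists>k. max_elt y k" if "y \<notin> ?E" "\<forall>j<M. y j = evens x j" for y
  proof -
    have "interleave y (\<lambda>i. i < M \<and> odds x i) \<notin> U"
      using that(1) by (metis evens_interleave image_eqI)
    then have "deleted y (\<lambda>i. i < M \<and> odds x i)"
      using M[of y "\<lambda>i. i < M \<and> odds x i"] that(2) by auto
    then show ?thesis
      unfolding max_elt_def by (elim deleted_truncation) blast
  qed
  have max_elt_max: "y k" "k < j \<Longrightarrow> \<not> y j" if "max_elt y k" for y k j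
    using that unfolding max_elt_def by force+
  \<comment> \<open>Near \<open>evens x\<close>, the set \<open>F - ?E\<close> is scattered, and \<open>q\<close> is one of its isolated points. As
    both \<open>F - ?E\<close> and \<open>F \<inter> ?E\<close> are dense in \<open>F\<close>, this is a contradiction.\<close>
  obtain q L where q: "q \<in> F - ?E"
    and iso: "\<And>y. \<lbrakk>y \<in> F - ?E; \<forall>j<L. y j = q j\<rbrakk> \<Longrightarrow> y = q"
  proof (cases "\<exists>q k. q \<in> F - ?E \<and> (\<forall>j<M. q j = evens x j) \<and> max_elt q k \<and> 2 * M \<le> k")
    case True
    then obtain q k where q: "q \<in> F - ?E" "\<forall>j<M. q j = evens x j" "max_elt q k" "2 * M \<le> k"
      by blast
    \<comment> \<open>As \<open>2 * M \<le> k\<close>, a point of \<open>F - ?E\<close> this close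
      to \<open>q\<close> contains \<open>k\<close> as its largest element, so its digits up to
      \<open>k\<close> determine it.\<close>
    have "y = q" if y: "y \<in> F - ?E" "\<forall>j<Suc k. y j = q j" for y
    proof -
      have "\<forall>j<M. y j = evens x j"
        using y(2) q(2,4) by simp
      then obtain k' where k': "max_elt y k'"
        using max_elt y(1) by blast
      then obtain N where N: "N < M" "\<forall>j>2 * N. y j \<longleftrightarrow> j = k'"
        unfolding max_elt_def by blast
      have "y k"
        using y(2) max_elt_max(1)[OF q(3)] by simp
      then have "k' = k"
        using N q(4) by simp
      show "y = q"
      proof
        fix j
        show "y j = q j"
          using y(2) max_elt_max(2)[OF q(3), of j] max_elt_max(2)[OF k', of j] \<open>k' = k\<close>
          by (cases "j < Suc k") auto
      qed
    qed
    then show thesis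
      using that[of q "Suc k"] q by simp
  next
    case False
    obtain q where q: "q \<in> F - ?E" "\<forall>j<M. q j = evens x j"
      using clN[OF x(2), of M] by auto
    \<comment> \<open>Here only finitely many digits of the nearby points of \<open>F - ?E\<close>
      can be nonzero.\<close>
    have bound: "\<not> y j" if y: "y \<in> F - ?E" "\<forall>j<M. y j = evens x j" "2 * M \<le> j" for y j
    proof -
      obtain k where k: "max_elt y k"
        using max_elt y by blast
      then have "k < 2 * M"
        using False y by force
      then show ?thesis
        using max_elt_max(2)[OF k, of j] y(3) by simp
    qed
    have "y = q" if y: "y \<in> F - ?E" "\<forall>j<2 * M. y j = q j" for y
    proof
      fix j
      have "\<forall>j<M. y j = evens x j"
        using y(2) q(2) by simp
      then show "y j = q j"
        using y bound[of y j] bound[of q j] q by (cases "j < 2 * M") auto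
    qed
    then show thesis
      using that[of q "2 * M"] q by simp
  qed
  \<comment> \<open>A point of the image close to \<open>q\<close> would be a limit of
    \<open>F - ?E\<close>, whose only point there is \<open>q\<close>.\<close>
  obtain e where e: "e \<in> F \<inter> ?E" "\<forall>j<L. e j = q j"
    using clE[of q L] q by auto
  then have "e \<noteq> q"
    using q by auto
  then obtain i where i: "e i \<noteq> q i"
    by (auto simp: fun_eq_iff)
  obtain y where y: "y \<in> F - ?E" "\<forall>j<max L (Suc i). y j = e j"
    using clN[of e "max L (Suc i)"] e(1) by auto
  then have "y = q"
    using iso e(2) by simp
  with y(2) i show False
    by simp
qed simp

section \<open>Failure of openness\<close>

lemma evens_not_open_on_open:
  assumes V: "openin (subtopology cantor_set punctured_square) V" and "V \<noteq> {}"
    and om: "open_map (subtopology (subtopology cantor_set punctured_square) V)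
      (subtopology cantor_set (evens ` V)) evens"
  shows False
proof -
  obtain x where x: "x \<in> V"
    using assms(2) by blast
  obtain M where M: "\<And>y z. \<lbrakk>\<forall>j<M. y j = evens x j; \<forall>j<M. z j = odds x j; \<not> deleted y z\<rbrakk>
      \<Longrightarrow> interleave y z \<in> V"
    using openin_punctured_squareD[OF V x] by blast
  \<comment> \<open>Digits \<open>N\<close> to \<open>2 * N\<close> of \<open>p\<close> will be the
    first \<open>M\<close> digits of \<open>odds x\<close> and two ones, so \<open>W\<^sub>p\<close>
    refines the cylinder of length \<open>M\<close> around \<open>odds x\<close>.\<close>
  define N where "N = Suc M"
  \<comment> \<open>The element \<open>2 * N - 1\<close> of \<open>p\<close> ensures that no point over \<open>p\<close> is deleted.\<close>
  define p where "p j \<longleftrightarrow> (if j < M then evens x j else if j < N then False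
     else if j < N + M then odds x (j - N) else j \<le> 2 * N)" for j
  define w where "w = (\<lambda>i. p (N + i))"
  have p_top: "p (2 * M + 1)" "p (2 * N)" and p_above: "\<And>j. 2 * N < j \<Longrightarrow> \<not> p j"
    by (auto simp: p_def N_def)
  have not_deleted_p: "\<not> deleted p w"
  proof
    assume "deleted p w"
    then obtain N' k where k: "2 * N' < k" "\<forall>j>2 * N'. p j \<longleftrightarrow> j = k"
      unfolding deleted_def by blast
    then have "p k"
      by blast
    then have "k \<le> 2 * N"
      using p_above not_le by blast
    then have "2 * N' < 2 * M + 1"
      using k(1) unfolding N_def by presburger
    then have "2 * M + 1 = k" "2 * N = k"
      using k(2) p_top unfolding N_def by auto
    then show False
      unfolding N_def by simp
  qed
  define B where "B = {x' \<in> V. \<forall>i\<le>N. odds x' i = w i}"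
  have "openin cantor_set {x'. \<forall>i\<le>N. odds x' i = w i}"
    unfolding openin_cantor_set odds_def by (auto intro!: exI[of _ "2 * N + 2"])
  moreover have "B = {x'. \<forall>i\<le>N. odds x' i = w i} \<inter> (punctured_square \<inter> V)"
    using openin_subset[OF V] by (auto simp: B_def)
  ultimately have "openin (subtopology (subtopology cantor_set punctured_square) V) B"
    unfolding subtopology_subtopology openin_subtopology by blast
  then have "openin (subtopology cantor_set (evens ` V)) (evens ` B)"
    using om unfolding open_map_def by blast
  then obtain T where T: "openin cantor_set T" "evens ` B = T \<inter> evens ` V"
    unfolding openin_subtopology by blast
  have "interleave p w \<in> V"
    using not_deleted_p by (intro M) (auto simp: p_def w_def N_def)
  then have "interleave p w \<in> B"
    by (simp add: B_def)
  then have "p \<in> T"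
    using T(2) by (metis IntD1 evens_interleave image_eqI)
  then obtain L where L: "\<And>y. (\<forall>j<L. y j = p j) \<Longrightarrow> y \<in> T"
    using T(1) unfolding openin_cantor_set by blast
  define k where "k = max L (Suc (2 * N))"
  define y where "y = p(k := True)"
  have k: "L \<le> k" "2 * N < k"
    by (auto simp: k_def)
  have "y \<in> T"
    using k by (intro L) (simp add: y_def)
  \<comment> \<open>Deletion over a zero-padded point needs a second largest element below
    \<open>2 * M\<close>; that of \<open>y\<close> is \<open>2 * N\<close>.\<close>
  have "\<not> deleted y (\<lambda>i. i < M \<and> odds x i)"
  proof
    assume "deleted y (\<lambda>i. i < M \<and> odds x i)"
    then obtain N' k' where *: "N' < M" "\<And>j. 2 * N' < j \<Longrightarrow> y j \<longleftrightarrow> j = k'"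
      by (elim deleted_truncation) blast
    have "y (2 * N)" "y k"
      using p_top by (auto simp: y_def)
    then have "2 * N = k'" "k = k'"
      using * k(2) by (auto simp: N_def)
    with k(2) show False
      by simp
  qed
  then have "interleave y (\<lambda>i. i < M \<and> odds x i) \<in> V"
    using k by (intro M) (auto simp: y_def p_def N_def)
  then have "y \<in> evens ` V"
    by (metis evens_interleave image_eqI)
  then have "y \<in> evens ` B"
    using \<open>y \<in> T\<close> T(2) by simp
  then obtain x' where x': "x' \<in> B" "evens x' = y"
    by auto
  have "deleted y (odds x')"
    unfolding deleted_def
  proof (intro exI conjI)
    show "2 * N < k" "y (2 * N)" "\<forall>j>2 * N. y j \<longleftrightarrow> j = k"
      using k p_top p_above by (auto simp: y_def)
    show "\<forall>i\<le>N. odds x' i = y (N + i)"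
      using x'(1) k(2) by (auto simp: B_def w_def y_def)
  qed
  moreover have "x' \<in> punctured_square"
    using x'(1) openin_subset[OF V] by (auto simp: B_def)
  ultimately show False
    using x'(2) by (simp add: punctured_square_def)
qed

theorem mainTheorem1:
  "\<exists>(S :: (nat \<Rightarrow> bool) set) (Y :: (nat \<Rightarrow> bool) topology) (f :: (nat \<Rightarrow> bool) \<Rightarrow> (nat \<Rightarrow> bool)).
     S \<subseteq> topspace cantor_set \<and>
     metrizable_space Y \<and>
     continuous_map (subtopology cantor_set S) Y f \<and>
     f ` topspace (subtopology cantor_set S) = topspace Y \<and>
     (\<forall>U. openin (subtopology cantor_set S) U \<longrightarrow> resolvable_in Y (f ` U)) \<and>
     \<not> scatteredly_open (subtopology cantor_set S) Y f"
proof (intro exI conjI allI impI notI)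
  show "metrizable_space cantor_set"
    by (rule metrizable_space_cantor_set)
  show "continuous_map (subtopology cantor_set punctured_square) cantor_set evens"
    using continuous_map_evens by (rule continuous_map_from_subtopology)
  show "evens ` topspace (subtopology cantor_set punctured_square) = topspace cantor_set"
    by (simp add: evens_image_punctured_square)
  show "resolvable_in cantor_set (evens ` U)"
    if "openin (subtopology cantor_set punctured_square) U" for U
    using that by (rule resolvable_evens_image)
  have "topspace (subtopology cantor_set punctured_square) \<noteq> {}"
    using evens_image_punctured_square by auto
  then show False
    if "scatteredly_open (subtopology cantor_set punctured_square) cantor_set evens"
    by (rule scatteredly_open_imp_open_on_clopen[OF that]) (use evens_not_open_on_open in blast)+
qed simp

end
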